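(* Let $K$ be a non-degenerate tetrahedral Delaunay mesh embedded in $\mathbb{R}^3$ and let $\tau$ be an internal vertex of $K$. Then the signed volume of the circumcentric dual $\star\tau$ is positive.
   Context: A tetrahedral mesh is a finite simplicial complex of dimension $3$ embedded in $\mathbb{R}^3$ which is a 3-manifold, possibly with boundary; a vertex is internal if it does not lie in the boundary. It is Delaunay if the open circumscribed ball of every tetrahedron contains no vertex of the mesh, and non-degenerate if moreover, for any two tetrahedra sharing a triangle, the vertex of one not in the shared triangle lies strictly outside the circumsphere of the other. Simplices are non-degenerate; $c_\sigma$ denotes the circumcenter of a simplex $\sigma$ (taken in the affine hull of $\sigma$), with $c_\sigma=\sigma$ for a vertex; $\prec$ means "is a face of". Signed volume of the dual of a vertex $\tau$: for each chain $\tau\prec\sigma^1\prec\sigma^2\prec\sigma^3$ with $\sigma^i$ an $i$-simplex of the mesh, the elementary dual simplex is the (possibly degenerate) tetrahedron with vertices $c_\tau,c_{\sigma^1},c_{\sigma^2},c_{\sigma^3}$. Its sign is $s=s_0 s_1 s_2$, where for $i=0,1,2$ (with $\sigma^0=\tau$) $s_i=+1$ if, in the affine hull of $\sigma^{i+1}$, the circumcenter $c_{\sigma^{i+1}}$ lies in the same half space relative to the affine hull of $\sigma^i$ as the vertex of $\sigma^{i+1}$ not in $\sigma^i$, and $s_i=-1$ otherwise. The signed volume of $\star\tau$ is the sum, over all such chains, of $s$ times the (unsigned) volume of the elementary dual simplex. *)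

theory Defs
  imports "HOL-Analysis.Analysis"
begin

section \<open>Tetrahedral meshes\<close>

text \<open>
  A mesh is a set of geometric simplices, i.e. convex hulls of affinely independent points
  (\<^const>\<open>simplex\<close>), forming a \<^const>\<open>simplicial_complex\<close>, so it is finite, closed under
  faces, and embedded in space by construction. The vertex set of a simplex is recovered as its
  set of extreme points. The library lets the empty set count as the \<open>-1\<close>-simplex; it never
  appears below, where dimensions are always prescribed.
\<close>

definition simplex_verts :: "(real^3) set \<Rightarrow> (real^3) set" where
  "simplex_verts S = {v. v extreme_point_of S}"

definition mesh_verts :: "(real^3) set set \<Rightarrow> (real^3) set" where
  "mesh_verts K = {v. {v} \<in> K}"

definition half_space3 :: "(real^3) set" where
  "half_space3 = {x. 0 \<le> x $ 3}"

text \<open>The Hausdorff and second countability axioms hold automatically for subsets of \<open>real^3\<close>.\<close>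

definition manifold3_with_boundary :: "(real^3) set \<Rightarrow> bool" where
  "manifold3_with_boundary M \<longleftrightarrow>
     (\<forall>x\<in>M. \<exists>U V. openin (top_of_set M) U \<and> x \<in> U \<and>
        openin (top_of_set half_space3) V \<and> U homeomorphic V)"

definition manifold3_interior :: "(real^3) set \<Rightarrow> (real^3) set" where
  "manifold3_interior M =
     {x \<in> M. \<exists>U V. openin (top_of_set M) U \<and> x \<in> U \<and>
        open (V :: (real^3) set) \<and> U homeomorphic V}"

definition manifold3_boundary :: "(real^3) set \<Rightarrow> (real^3) set" where
  "manifold3_boundary M = M - manifold3_interior M"

definition tetrahedral_mesh :: "(real^3) set set \<Rightarrow> bool" where
  "tetrahedral_mesh K \<longleftrightarrow>
     simplicial_complex K \<and> (\<exists>S\<in>K. 3 simplex S) \<and> manifold3_with_boundary (\<Union>K)"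

definition internal_vertex :: "(real^3) set set \<Rightarrow> real^3 \<Rightarrow> bool" where
  "internal_vertex K v \<longleftrightarrow> v \<in> mesh_verts K \<and> v \<notin> manifold3_boundary (\<Union>K)"

section \<open>Circumcenters and the Delaunay condition\<close>

definition circumcenter :: "(real^3) set \<Rightarrow> real^3" where
  "circumcenter S =
     (THE c. c \<in> affine hull S \<and> (\<exists>r. \<forall>v\<in>simplex_verts S. dist c v = r))"

definition circumradius :: "(real^3) set \<Rightarrow> real" where
  "circumradius S = (THE r. \<forall>v\<in>simplex_verts S. dist (circumcenter S) v = r)"

definition delaunay :: "(real^3) set set \<Rightarrow> bool" where
  "delaunay K \<longleftrightarrow>
     (\<forall>S\<in>K. 3 simplex S \<longrightarrow> ball (circumcenter S) (circumradius S) \<inter> mesh_verts K = {})"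

definition nondegenerate_delaunay :: "(real^3) set set \<Rightarrow> bool" where
  "nondegenerate_delaunay K \<longleftrightarrow> delaunay K \<and>
     (\<forall>S\<in>K. \<forall>T\<in>K. \<forall>F. 3 simplex S \<and> 3 simplex T \<and> S \<noteq> T \<and>
        2 simplex F \<and> F face_of S \<and> F face_of T \<longrightarrow>
        (\<forall>v\<in>simplex_verts T - simplex_verts F. circumradius S < dist (circumcenter S) v))"

section \<open>The signed volume of the dual of a vertex\<close>

text \<open>
  For a facet \<open>F\<close> of a simplex \<open>S\<close>: \<open>x\<close> and \<open>y\<close> lie in the same one of the two open half spaces
  into which \<open>affine hull F\<close> divides \<open>affine hull S\<close>. Open versus closed half spaces makes no
  difference to the signed volume: a circumcenter of \<open>S\<close> lying in \<open>affine hull F\<close> equals that of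
  \<open>F\<close>, and the elementary dual simplex then has volume zero.
\<close>

definition same_half_space ::
    "(real^3) set \<Rightarrow> (real^3) set \<Rightarrow> real^3 \<Rightarrow> real^3 \<Rightarrow> bool" where
  "same_half_space F S x y \<longleftrightarrow> x \<in> affine hull S \<and> y \<in> affine hull S \<and>
     (\<exists>a b. affine hull F = affine hull S \<inter> {z. a \<bullet> z = b} \<and> a \<bullet> x > b \<and> a \<bullet> y > b)"

text \<open>A facet omits exactly one vertex of the simplex, so the quantifier over \<open>w\<close> ranges over
  a single point.\<close>

definition facet_sign :: "(real^3) set \<Rightarrow> (real^3) set \<Rightarrow> real" where
  "facet_sign F S =
     (if \<forall>w \<in> simplex_verts S - simplex_verts F. same_half_space F S (circumcenter S) w
      then 1 else -1)"

definition dual_chains ::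
    "(real^3) set set \<Rightarrow> real^3 \<Rightarrow> ((real^3) set \<times> (real^3) set \<times> (real^3) set) set" where
  "dual_chains K v =
     {(S1, S2, S3). S1 \<in> K \<and> S2 \<in> K \<and> S3 \<in> K \<and>
        1 simplex S1 \<and> 2 simplex S2 \<and> 3 simplex S3 \<and>
        {v} face_of S1 \<and> S1 face_of S2 \<and> S2 face_of S3}"

definition signed_dual_volume :: "(real^3) set set \<Rightarrow> real^3 \<Rightarrow> real" where
  "signed_dual_volume K v =
     (\<Sum>(S1, S2, S3) \<in> dual_chains K v.
        facet_sign {v} S1 * facet_sign S1 S2 * facet_sign S2 S3 *
        measure lebesgue
          (convex hull {circumcenter {v}, circumcenter S1, circumcenter S2, circumcenter S3}))"

end

theory Submission
  imports Defs
begin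

text \<open>
  Take \<open>\<tau>\<close> as origin. The signed volume of an elementary dual simplex is, up to the orientation of
  the flag, a determinant in its circumcenters, so the signed volume of the dual splits into pyramids
  over the dual polygons of the edges at \<open>\<tau>\<close>, each of positive height (half the edge length). It
  therefore suffices that every dual polygon has positive signed area. The signed area may be measured
  from any point, and measured from a vertex of the polygon, that is, from the circumcenter of a
  tetrahedron around the edge, every side contributes nonnegatively: its signed length is positive by
  the non-degenerate Delaunay condition applied to the two tetrahedra at the dual triangle, and its
  signed distance from that circumcenter is nonnegative because no mesh vertex is closer to the
  circumcenter than \<open>\<tau>\<close>. That every triangle at \<open>\<tau>\<close> has exactly one tetrahedron on each side
  comes from \<open>\<tau>\<close> being an interior point of the mesh, by invariance of domain.
\<close>

unbundle cross3_syntax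

section \<open>Dual polygons\<close>

lemma det_nonzero_nonzero:
  fixes a b c :: "real^3"
  assumes "(a \<times> b) \<bullet> c \<noteq> 0"
  shows "a \<noteq> 0" "b \<noteq> 0" "c \<noteq> 0" "a \<noteq> b" "a \<noteq> c" "b \<noteq> c"
  using assms by (auto simp: dot_cross_self)

lemma cross_triple_skew: "(a \<times> b) \<bullet> c = - ((a \<times> c) \<bullet> b)" for a :: "real^3"
  by (simp add: cross3_simps)

text \<open>The vector \<open>q - q'\<close> is orthogonal to \<open>a\<close> and \<open>b\<close>,
  hence a multiple of \<open>a \<times> b\<close>, positive because of \<open>c\<close>; and
  \<open>p - x\<close> is orthogonal to \<open>a\<close>. In the application \<open>q\<close> and
  \<open>q'\<close> are the circumcenters of the two tetrahedra at a triangle, \<open>p\<close> is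
  the center of that triangle, and \<open>x\<close> is the point from which the dual polygon is
  seen.\<close>

lemma dual_edge_term:
  fixes a b p x c c' q q' :: "real^3"
  assumes c: "0 < (a \<times> b) \<bullet> c"
    and qa: "(q - q') \<bullet> a = 0" and qb: "(q - q') \<bullet> b = 0" and qc: "0 < (q - q') \<bullet> c"
    and pa: "p \<bullet> a = x \<bullet> a"
  shows "\<exists>l>0. (a \<times> (p - x)) \<bullet> (q - q') = l * ((p - x) \<bullet> b)"
proof -
  define n where "n = a \<times> b"
  define d where "d = q - q'"
  have "n \<times> d = 0"
    using qa qb by (simp add: n_def d_def cross_skew[of "a \<times> b"] Lagrange)
  \<comment> \<open>A second product with \<open>n\<close> turns parallelism into an explicit
    coefficient, through the Lagrange identity.\<close>
  then have "n \<times> (n \<times> d) = 0" by simp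
  then have eq: "(n \<bullet> n) *\<^sub>R d = (n \<bullet> d) *\<^sub>R n"
    by (simp add: Lagrange)
  have n0: "0 < n \<bullet> n" using c by (auto simp: n_def)
  define l where "l = (n \<bullet> d) / (n \<bullet> n)"
  have d: "d = l *\<^sub>R n"
    using arg_cong[OF eq, of "\<lambda>v. (1 / (n \<bullet> n)) *\<^sub>R v"] n0 by (simp add: l_def)
  have "0 < l"
    using qc c unfolding d_def[symmetric] d n_def[symmetric] by (simp add: zero_less_mult_iff)
  moreover have "0 < a \<bullet> a" using c by auto
  moreover have "(a \<times> (p - x)) \<bullet> d = (l * (a \<bullet> a)) * ((p - x) \<bullet> b)"
    using pa by (simp add: d n_def dot_cross inner_diff_left inner_diff_right inner_commute algebra_simps)
  ultimately show ?thesis unfolding d_def by (metis mult_pos_pos)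
qed

text \<open>
  The sum is twice the signed area of the dual polygon of an edge \<open>a\<close>, seen from the midpoint of
  the edge and weighted with the length of \<open>a\<close>. Because \<open>Q\<close> is symmetric while the orientation is
  alternating, the area does not change when it is seen from a vertex \<open>Q b1 c1\<close> of the polygon
  instead. From there every side contributes a nonnegative amount, since its length is positive by
  the strict Delaunay condition and \<open>Q b1 c1\<close> is at least as close to the origin as to \<open>b\<close>.
\<close>

lemma dual_polygon_area_pos:
  fixes a :: "real^3" and M :: "((real^3) \<times> (real^3)) set"
    and P :: "real^3 \<Rightarrow> real^3" and Q :: "real^3 \<Rightarrow> real^3 \<Rightarrow> real^3"
  assumes fin: "finite M" and ne: "M \<noteq> {}"
    and sym: "\<And>b c. (b, c) \<in> M \<Longrightarrow> (c, b) \<in> M"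
    and Qsym: "\<And>b c. Q b c = Q c b"
    and nz: "\<And>b c. (b, c) \<in> M \<Longrightarrow> (a \<times> b) \<bullet> c \<noteq> 0"
    and Qa: "\<And>b c. (b, c) \<in> M \<Longrightarrow> Q b c \<bullet> a = (a \<bullet> a) / 2"
    and Qb: "\<And>b c. (b, c) \<in> M \<Longrightarrow> Q b c \<bullet> b = (b \<bullet> b) / 2"
    and Pa: "\<And>b c. (b, c) \<in> M \<Longrightarrow> P b \<bullet> a = (a \<bullet> a) / 2"
    and Pb: "\<And>b c. (b, c) \<in> M \<Longrightarrow> P b \<bullet> b = (b \<bullet> b) / 2"
    and opposite: "\<And>b c. (b, c) \<in> M \<Longrightarrow>
      \<exists>c'. (b, c') \<in> M \<and> sgn ((a \<times> b) \<bullet> c') = - sgn ((a \<times> b) \<bullet> c)"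
    and unique: "\<And>b c c'. (b, c) \<in> M \<Longrightarrow> (b, c') \<in> M \<Longrightarrow>
      sgn ((a \<times> b) \<bullet> c') = sgn ((a \<times> b) \<bullet> c) \<Longrightarrow> c = c'"
    and empty: "\<And>b c b' c'. (b, c) \<in> M \<Longrightarrow> (b', c') \<in> M \<Longrightarrow> Q b c \<bullet> b' \<le> (b' \<bullet> b') / 2"
    and strict: "\<And>b c c'. (b, c) \<in> M \<Longrightarrow> (b, c') \<in> M \<Longrightarrow> c \<noteq> c' \<Longrightarrow>
      Q b c \<bullet> c' < (c' \<bullet> c') / 2"
  shows "0 < (\<Sum>(b, c)\<in>M. sgn ((a \<times> b) \<bullet> c) * ((a \<times> P b) \<bullet> Q b c))"
proof -
  obtain c1 b1 where b1: "(b1, c1) \<in> M" using ne by auto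
  define x where "x = Q b1 c1"
  have xa: "x \<bullet> a = (a \<bullet> a) / 2" using Qa[OF b1] by (simp add: x_def)
  define s where "s b c = sgn ((a \<times> b) \<bullet> c)" for b c :: "real^3"
  have s_skew: "s b c = - s c b" for b c
    using cross_triple_skew[of a b c] by (simp add: s_def)
  have swap: "bij_betw prod.swap M M"
    using sym by (intro bij_betwI[where g = prod.swap]) auto
  have "(\<Sum>(b, c)\<in>M. s b c * ((a \<times> x) \<bullet> Q b c)) = (\<Sum>(b, c)\<in>M. s c b * ((a \<times> x) \<bullet> Q c b))"
    by (subst sum.reindex_bij_betw[OF swap, symmetric]) (simp add: case_prod_unfold)
  also have "\<dots> = - (\<Sum>(b, c)\<in>M. s b c * ((a \<times> x) \<bullet> Q b c))"
    by (simp add: case_prod_unfold flip: sum_negf) (metis (no_types) Qsym s_skew mult_minus_left)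
  finally have "(\<Sum>(b, c)\<in>M. s b c * ((a \<times> x) \<bullet> Q b c)) = 0" by simp
  then have shift: "(\<Sum>(b, c)\<in>M. s b c * ((a \<times> P b) \<bullet> Q b c)) =
      (\<Sum>(b, c)\<in>M. s b c * ((a \<times> (P b - x)) \<bullet> Q b c))"
    by (simp add: Cross3.right_diff_distrib inner_diff_left case_prod_unfold sum_subtractf
        algebra_simps)
  \<comment> \<open>\<open>B\<close> indexes the sides of the dual polygon; \<open>C b\<close> will
    turn out to have two elements, one for each end of the side.\<close>
  define B where "B = fst ` M"
  define C where "C b = {c. (b, c) \<in> M}" for b
  have M: "M = Sigma B C" by (force simp: B_def C_def)
  have finB: "finite B" using fin by (simp add: B_def)
  have finC: "finite (C b)" for b
    by (rule finite_subset[of _ "snd ` M"]) (use fin in \<open>force simp: C_def\<close>)+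
  define g where "g b = (\<Sum>c\<in>C b. s b c * ((a \<times> (P b - x)) \<bullet> Q b c))" for b
  have g: "\<exists>l>0. g b = l * ((P b - x) \<bullet> b)" if b: "b \<in> B" for b
  proof -
    obtain c where c: "(b, c) \<in> M" using b by (auto simp: B_def)
    obtain c' where c': "(b, c') \<in> M" "s b c' = - s b c" using opposite[OF c] by (auto simp: s_def)
    have "s b c \<noteq> 0" using nz[OF c] by (simp add: s_def sgn_zero_iff)
    then obtain d d' where d: "(b, d) \<in> M" "s b d = 1" "(b, d') \<in> M" "s b d' = -1"
      using c c' unfolding s_def by (metis minus_minus sgn_1_neg sgn_1_pos sgn_if)
    have C: "C b = {d, d'}"
    proof
      show "C b \<subseteq> {d, d'}"
      proof
        fix e assume "e \<in> C b"
        then have e: "(b, e) \<in> M" by (simp add: C_def)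
        have "s b e = 1 \<or> s b e = -1"
          using nz[OF e] by (auto simp: s_def sgn_if)
        then show "e \<in> {d, d'}"
          using unique[OF d(1) e] unique[OF d(3) e] d by (auto simp: s_def)
      qed
    qed (use d in \<open>auto simp: C_def\<close>)
    have dd: "d \<noteq> d'" using d by auto
    \<comment> \<open>\<open>Qb\<close> for the swapped pair puts \<open>Q b d\<close> on the
      bisector plane of \<open>d\<close>; by \<open>strict\<close>, \<open>Q b d'\<close> lies
      strictly on the origin's side of it.\<close>
    have "0 < (Q b d - Q b d') \<bullet> d"
      using strict[OF d(3) d(1)] Qb[OF sym[OF d(1)]] dd Qsym[of b d] by (simp add: inner_diff_left)
    moreover have "0 < (a \<times> b) \<bullet> d" using d(2) by (simp add: s_def sgn_1_pos)
    moreover have "P b \<bullet> a = x \<bullet> a" using Pa[OF d(1)] xa by simp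
    moreover have "g b = (a \<times> (P b - x)) \<bullet> (Q b d - Q b d')"
      using d dd by (simp add: g_def C inner_diff_right)
    ultimately show ?thesis
      using dual_edge_term[of a b d "Q b d" "Q b d'" "P b" x] Qa[OF d(1)] Qa[OF d(3)]
        Qb[OF d(1)] Qb[OF d(3)] by (simp add: inner_diff_left)
  qed
  have Pxb: "(P b - x) \<bullet> b = (b \<bullet> b) / 2 - x \<bullet> b" if "b \<in> B" for b
    using that Pb by (auto simp: B_def inner_diff_left)
  have nonneg: "0 \<le> g b" if b: "b \<in> B" for b
  proof -
    have "x \<bullet> b \<le> (b \<bullet> b) / 2" using b empty[OF b1] by (auto simp: B_def x_def)
    then show ?thesis using g[OF b] Pxb[OF b] by (auto simp: zero_le_mult_iff)
  qed
  \<comment> \<open>Some side must contribute strictly. The one of \<open>c2\<close> does: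
    \<open>c2\<close> lies opposite to \<open>c1\<close> across the triangle of \<open>b1\<close>,
    so \<open>strict\<close> applies to \<open>x\<close> and \<open>c2\<close>.\<close>
  obtain c2 where c2: "(b1, c2) \<in> M" "s b1 c2 = - s b1 c1"
    using opposite[OF b1] by (auto simp: s_def)
  have "c1 \<noteq> c2" using c2 nz[OF b1] by (auto simp: s_def sgn_zero_iff)
  then have "x \<bullet> c2 < (c2 \<bullet> c2) / 2" using strict[OF b1 c2(1)] by (simp add: x_def)
  moreover have c2B: "c2 \<in> B" using sym[OF c2(1)] by (force simp: B_def)
  ultimately have "0 < g c2" using g[OF c2B] Pxb[OF c2B] by (auto simp: zero_less_mult_iff)
  then have "0 < sum g B" using sum_pos2[OF finB c2B] nonneg by auto
  also have "sum g B = (\<Sum>(b, c)\<in>M. s b c * ((a \<times> (P b - x)) \<bullet> Q b c))"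
    unfolding M g_def using finB finC by (subst sum.Sigma) auto
  finally show ?thesis using shift by (simp add: s_def)
qed

section \<open>Simplices with a prescribed vertex\<close>

text \<open>By independence a linear functional with the prescribed values exists;
  \<open>adjoint f 1\<close> represents it as an inner product.\<close>

lemma exists_dual_vector:
  fixes B :: "'a::euclidean_space set"
  assumes "independent B"
  obtains y where "\<And>b. b \<in> B \<Longrightarrow> y \<bullet> b = g b"
proof -
  obtain f :: "'a \<Rightarrow> real" where f: "linear f" "\<And>b. b \<in> B \<Longrightarrow> f b = g b"
    using linear_independent_extend[OF assms] by metis
  have "adjoint f 1 \<bullet> b = g b" if "b \<in> B" for b
    using adjoint_works[OF f(1), of b 1] f(2)[OF that] by (simp add: inner_commute)
  then show ?thesis using that by blast
qed

text \<open>Projecting orthogonally to the span keeps all inner products with \<open>B\<close>.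
  Membership in the span will place circumcenters in the affine hull.\<close>

lemma exists_dual_vector_span:
  fixes B :: "'a::euclidean_space set"
  assumes "independent B"
  obtains y where "y \<in> span B" "\<And>b. b \<in> B \<Longrightarrow> y \<bullet> b = g b"
proof -
  obtain x where x: "\<And>b. b \<in> B \<Longrightarrow> x \<bullet> b = g b" using exists_dual_vector[OF assms] by metis
  obtain y z where y: "y \<in> span B" and z: "\<And>w. w \<in> span B \<Longrightarrow> orthogonal z w" and "x = y + z"
    using orthogonal_subspace_decomp_exists[of B x] by blast
  then have "y \<bullet> b = g b" if "b \<in> B" for b
    using x[OF that] z[OF span_base[OF that]] by (simp add: inner_add_left orthogonal_def)
  then show ?thesis using that y by blast
qed

text \<open>The difference lies in the span and is orthogonal to it.\<close>

lemma dual_vector_span_unique: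
  fixes B :: "'a::euclidean_space set"
  assumes "x \<in> span B" "y \<in> span B" "\<And>b. b \<in> B \<Longrightarrow> x \<bullet> b = y \<bullet> b"
  shows "x = y"
proof -
  have "orthogonal (x - y) b" if "b \<in> span B" for b
    using orthogonal_to_span[OF that, of "x - y"] assms(3)
    by (simp add: orthogonal_def inner_diff_left)
  from this[of "x - y"] show ?thesis
    using span_diff[OF assms(1,2)] by (simp add: orthogonal_self)
qed

section \<open>Linear independence and the triple product\<close>

lemma det_nonzero_independent:
  fixes a b c :: "real^3"
  assumes "(a \<times> b) \<bullet> c \<noteq> 0"
  shows "independent {a, b, c}"
proof -
  have "a \<notin> span {b, c}"
  proof
    assume "a \<in> span {b, c}"
    then obtain k l where "a - k *\<^sub>R b = l *\<^sub>R c" by (auto simp: span_breakdown_eq)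
    then have "a = k *\<^sub>R b + l *\<^sub>R c" by (simp add: diff_eq_eq add.commute)
    then show False using assms
      by (simp add: cross_add_left cross_mult_left inner_add_left dot_cross_self cross_triple[of c b c])
  qed
  moreover have "b \<notin> span {c}"
    using assms by (auto simp: span_singleton cross_mult_right dot_cross_self)
  moreover have "c \<noteq> 0" using assms by auto
  ultimately show ?thesis
    using det_nonzero_nonzero[OF assms] by (auto simp: independent_insert)
qed

text \<open>Let \<open>f\<close> and \<open>g\<close> be dual to \<open>c\<close> and
  \<open>b\<close>. Then \<open>f\<close> is parallel to \<open>a \<times> b\<close>; if the
  determinant vanishes, pairing with \<open>c\<close> forces \<open>a \<times> b = 0\<close>, and
  expanding \<open>g \<times> (a \<times> b)\<close> then gives \<open>a = 0\<close>.\<close>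

lemma independent_det_nonzero:
  fixes a b c :: "real^3"
  assumes ind: "independent {a, b, c}" and ne: "a \<noteq> b" "a \<noteq> c" "b \<noteq> c"
  shows "(a \<times> b) \<bullet> c \<noteq> 0"
proof
  assume 0: "(a \<times> b) \<bullet> c = 0"
  obtain f where f: "\<And>x. x \<in> {a, b, c} \<Longrightarrow> f \<bullet> x = (if x = c then 1 else 0)"
    using exists_dual_vector[OF ind, of "\<lambda>x. if x = c then 1 else 0"] by blast
  obtain g where g: "\<And>x. x \<in> {a, b, c} \<Longrightarrow> g \<bullet> x = (if x = b then 1 else 0)"
    using exists_dual_vector[OF ind, of "\<lambda>x. if x = b then 1 else 0"] by blast
  have "f \<times> (a \<times> b) = 0" using f[of a] f[of b] ne by (simp add: Lagrange)
  then have "(a \<times> b) \<times> (f \<times> (a \<times> b)) = 0" by simp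
  then have "((a \<times> b) \<bullet> (a \<times> b)) *\<^sub>R f = ((a \<times> b) \<bullet> f) *\<^sub>R (a \<times> b)"
    using Lagrange[of "a \<times> b" f "a \<times> b"] by simp
  from arg_cong[OF this, of "\<lambda>v. v \<bullet> c"] have "a \<times> b = 0" using 0 f[of c] by simp
  then have "g \<times> (a \<times> b) = 0" by simp
  then have "a = 0" using g[of a] g[of b] ne by (simp add: Lagrange)
  then show False using ind dependent_zero by auto
qed

section \<open>Simplices described by their edge vectors at a point\<close>

text \<open>With edge vectors at \<open>p\<close> in place of vertices, affine independence becomes
  linear independence, affine hulls become translated spans, and faces through \<open>p\<close>
  become subsets of \<open>B\<close>.\<close>

definition corner :: "'a::real_vector \<Rightarrow> 'a set \<Rightarrow> 'a set" where
  "corner p B = convex hull (insert p ((+) p ` B))"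

lemma corner_affine_independent:
  fixes p :: "'a::euclidean_space"
  assumes "independent B"
  shows "\<not> affine_dependent (insert p ((+) p ` B))"
proof -
  have "0 \<notin> B" using assms dependent_zero by blast
  then have "p \<notin> (+) p ` B" by auto
  moreover have "(\<lambda>x. - p + x) ` (+) p ` B = B" by (simp add: image_image)
  ultimately show ?thesis using assms affine_dependent_iff_dependent[of p "(+) p ` B"] by simp
qed

lemma corner_card:
  fixes p :: "'a::euclidean_space"
  assumes "independent B"
  shows "card (insert p ((+) p ` B)) = Suc (card B)"
proof -
  have "0 \<notin> B" using assms dependent_zero by blast
  then have "p \<notin> (+) p ` B" by auto
  then show ?thesis using independent_imp_finite[OF assms] by (simp add: card_image)
qed

lemma corner_simplex:
  fixes p :: "'a::euclidean_space"
  assumes "independent B"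
  shows "int (card B) simplex corner p B"
  using corner_affine_independent[OF assms] corner_card[OF assms] unfolding corner_def
  by (intro simplex_convex_hull) auto

lemma simplex_corner:
  fixes p :: "'a::euclidean_space"
  assumes "n simplex S" "{p} face_of S"
  obtains B where "independent B" "int (card B) = n" "S = corner p B"
proof -
  obtain C where C: "\<not> affine_dependent C" "int (card C) = n + 1" "S = convex hull C"
    using assms(1) by (auto simp: simplex_def)
  have "p \<in> C"
    using assms(2) C extreme_point_of_convex_hull_affine_independent face_of_singleton by blast
  define B where "B = (\<lambda>x. - p + x) ` (C - {p})"
  have C': "insert p ((+) p ` B) = C" using \<open>p \<in> C\<close> by (auto simp: B_def image_image)
  have "independent B"
    using C(1) \<open>p \<in> C\<close> affine_dependent_iff_dependent[of p "C - {p}"]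
    by (simp add: B_def insert_absorb)
  then show ?thesis using that[of B] C C' corner_card[of B p] by (simp add: corner_def)
qed

lemma simplex_verts_corner:
  assumes "independent B"
  shows "simplex_verts (corner p B) = insert p ((+) p ` B)"
  using extreme_point_of_convex_hull_affine_independent[OF corner_affine_independent[OF assms]]
  by (auto simp: simplex_verts_def corner_def)

text \<open>The extreme points recover the vertices, and removing \<open>p\<close> recovers the edge
  vectors.\<close>

lemma corner_inject:
  fixes p :: "real^3"
  assumes "independent B" "independent B'" "corner p B = corner p B'"
  shows "B = B'"
proof -
  have "insert p ((+) p ` B) = insert p ((+) p ` B')"
    using simplex_verts_corner[OF assms(1), of p] simplex_verts_corner[OF assms(2), of p] assms(3)
    by simp
  from arg_cong[OF this, of "\<lambda>X. (\<lambda>x. - p + x) ` X"] have "insert 0 B = insert 0 B'"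
    by (simp add: image_image)
  moreover have "0 \<notin> B" "0 \<notin> B'" using assms dependent_zero by blast+
  ultimately show ?thesis by (simp add: insert_ident)
qed

lemma affine_hull_corner: "affine hull (corner p B) = (+) p ` span B"
  by (simp add: corner_def affine_hull_convex_hull affine_hull_insert_span_gen image_image)

lemma corner_face:
  fixes p :: "'a::euclidean_space"
  assumes "independent B" "A \<subseteq> B"
  shows "corner p A face_of corner p B"
  unfolding corner_def face_of_convex_hull_affine_independent[OF corner_affine_independent[OF assms(1)]]
  using assms(2) by (intro exI[of _ "insert p ((+) p ` A)"]) auto

text \<open>A face of a simplex is spanned by some of its vertices; \<open>p\<close> is among them
  because it is extreme in the whole simplex and hence in the face.\<close>

lemma face_corner:
  fixes p :: "'a::euclidean_space"
  assumes B: "independent B" and F: "F face_of corner p B" "p \<in> F"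
  obtains A where "A \<subseteq> B" "F = corner p A"
proof -
  obtain C where C: "C \<subseteq> insert p ((+) p ` B)" "F = convex hull C"
    using F(1)
    unfolding corner_def face_of_convex_hull_affine_independent[OF corner_affine_independent[OF B]]
    by auto
  have "p extreme_point_of corner p B"
    using extreme_point_of_convex_hull_affine_independent[OF corner_affine_independent[OF B]]
    by (simp add: corner_def)
  then have "p extreme_point_of F"
    using F extreme_point_of_face by blast
  then have "p \<in> C" using C(2) extreme_point_of_convex_hull by blast
  moreover obtain A where "A \<subseteq> B" "C - {p} = (+) p ` A"
    using C(1) by (metis Diff_subset_conv insert_is_Un subset_imageE)
  ultimately show ?thesis using that[of A] C(2) by (metis corner_def insert_Diff)
qed

lemma corner_singleton: "corner p {} = {p}"
  by (simp add: corner_def)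

section \<open>Circumcenters and elementary dual simplices\<close>

definition corner_center :: "real^3 \<Rightarrow> (real^3) set \<Rightarrow> real^3" where
  "corner_center p B = circumcenter (corner p B) - p"

text \<open>Squaring and expanding makes comparisons of distances linear in \<open>y\<close>: the
  boundary case is the perpendicular bisector plane of \<open>p\<close> and
  \<open>p + b\<close>.\<close>

lemma dist_corner_eq_iff:
  fixes p y b :: "'a::real_inner"
  shows "dist (p + y) (p + b) = norm y \<longleftrightarrow> y \<bullet> b = (b \<bullet> b) / 2"
    and "dist (p + y) (p + b) < norm y \<longleftrightarrow> y \<bullet> b > (b \<bullet> b) / 2"
    and "dist (p + y) (p + b) > norm y \<longleftrightarrow> y \<bullet> b < (b \<bullet> b) / 2"
  by (auto simp: dist_norm norm_eq norm_lt inner_diff_left inner_diff_right inner_commute)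

text \<open>Relative to \<open>p\<close>, the circumcenter is the unique point of the span lying on
  all bisector planes of the edges at \<open>p\<close>.\<close>

lemma corner_center:
  assumes B: "independent B"
  shows "corner_center p B \<in> span B"
    and "\<And>b. b \<in> B \<Longrightarrow> corner_center p B \<bullet> b = (b \<bullet> b) / 2"
    and "circumradius (corner p B) = norm (corner_center p B)"
proof -
  obtain y where y: "y \<in> span B" "\<And>b. b \<in> B \<Longrightarrow> y \<bullet> b = (b \<bullet> b) / 2"
    using exists_dual_vector_span[OF B, of "\<lambda>b. (b \<bullet> b) / 2"] by metis
  \<comment> \<open>The vertex \<open>p\<close> itself fixes the radius as
    \<open>norm z\<close>.\<close>
  have equi: "(\<forall>v\<in>simplex_verts (corner p B). dist (p + z) v = r) \<longleftrightarrow>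
      r = norm z \<and> (\<forall>b\<in>B. z \<bullet> b = (b \<bullet> b) / 2)" for z r
    using dist_corner_eq_iff(1)[of p z]
    by (auto simp: simplex_verts_corner[OF B] dist_norm)
  have "circumcenter (corner p B) = p + y"
    unfolding circumcenter_def affine_hull_corner
  proof (rule the_equality)
    show "p + y \<in> (+) p ` span B \<and> (\<exists>r. \<forall>v\<in>simplex_verts (corner p B). dist (p + y) v = r)"
      using y equi by auto
  next
    fix c
    assume c: "c \<in> (+) p ` span B \<and> (\<exists>r. \<forall>v\<in>simplex_verts (corner p B). dist c v = r)"
    then obtain z where z: "c = p + z" "z \<in> span B" by auto
    have zb: "z \<bullet> b = (b \<bullet> b) / 2" if "b \<in> B" for b
      using c equi that unfolding z(1) by blast
    have "z = y" by (rule dual_vector_span_unique[of z B y]) (simp_all add: z y zb)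
    then show "c = p + y" using z by simp
  qed
  then have cc: "corner_center p B = y" and c: "circumcenter (corner p B) = p + y"
    by (simp_all add: corner_center_def)
  show "corner_center p B \<in> span B" "\<And>b. b \<in> B \<Longrightarrow> corner_center p B \<bullet> b = (b \<bullet> b) / 2"
    using y by (simp_all add: cc)
  have "circumradius (corner p B) = norm y"
    unfolding circumradius_def c equi using y by auto
  then show "circumradius (corner p B) = norm (corner_center p B)" by (simp add: cc)
qed

lemma circumcenter_corner: "circumcenter (corner p B) = p + corner_center p B"
  by (simp add: corner_center_def)

text \<open>The definition allows any equation for the hyperplane of \<open>F\<close>; one given
  equation already decides. If \<open>x\<close> were not on the side of \<open>y\<close>, the
  segment between them would meet the hyperplane, although both ends are strictly positive for the
  other equation.\<close>

lemma same_half_space_iff: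
  assumes F: "affine hull F = affine hull S \<inter> {z. a \<bullet> z = b}"
    and x: "x \<in> affine hull S" and y: "y \<in> affine hull S" "a \<bullet> y > b"
  shows "same_half_space F S x y \<longleftrightarrow> a \<bullet> x > b"
proof
  assume "same_half_space F S x y"
  then obtain a' b' where F': "affine hull F = affine hull S \<inter> {z. a' \<bullet> z = b'}"
    and pos: "a' \<bullet> x > b'" "a' \<bullet> y > b'"
    by (auto simp: same_half_space_def)
  show "a \<bullet> x > b"
  proof (rule ccontr)
    assume neg: "\<not> a \<bullet> x > b"
    \<comment> \<open>The parameter at which the segment from \<open>y\<close> to \<open>x\<close>
      crosses the hyperplane.\<close>
    define t where "t = (a \<bullet> y - b) / (a \<bullet> y - a \<bullet> x)"
    define z where "z = (1 - t) *\<^sub>R y + t *\<^sub>R x"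
    have t: "0 \<le> t" "t \<le> 1" using neg y(2) by (auto simp: t_def divide_simps)
    have "t * (a \<bullet> y - a \<bullet> x) = a \<bullet> y - b" using neg y(2) by (simp add: t_def)
    then have "a \<bullet> z = b" by (simp add: z_def inner_add_right algebra_simps)
    moreover have "z \<in> affine hull S"
      using x y(1) by (simp add: z_def mem_affine)
    ultimately have "a' \<bullet> z = b'" using F F' by blast
    then have "(1 - t) * (a' \<bullet> y - b') + t * (a' \<bullet> x - b') = 0"
      by (simp add: z_def inner_add_right algebra_simps)
    moreover have "0 \<le> (1 - t) * (a' \<bullet> y - b')" "0 \<le> t * (a' \<bullet> x - b')"
      using t pos by auto
    ultimately have "(1 - t) * (a' \<bullet> y - b') = 0" "t * (a' \<bullet> x - b') = 0" by linarith+
    then show False using pos by auto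
  qed
next
  assume "a \<bullet> x > b"
  then show "same_half_space F S x y" using F x y by (auto simp: same_half_space_def)
qed

text \<open>The functional \<open>f\<close> that vanishes on \<open>B\<close> and is
  \<open>1\<close> at \<open>w\<close> cuts out the facet and reads off \<open>k\<close>, the
  \<open>w\<close>-coordinate of the circumcenter.\<close>

lemma facet_sign_corner:
  assumes ind: "independent (insert w B)" and w: "w \<notin> B"
    and k: "corner_center p (insert w B) - k *\<^sub>R w \<in> span B"
  shows "facet_sign (corner p B) (corner p (insert w B)) = (if k > 0 then 1 else -1)"
proof -
  have B: "independent B" using ind independent_mono by blast
  obtain f where "\<And>b. b \<in> insert w B \<Longrightarrow> f \<bullet> b = (if b = w then 1 else 0)"
    using exists_dual_vector[OF ind, of "\<lambda>b. if b = w then 1 else 0"] by blast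
  then have fw: "f \<bullet> w = 1" and fb: "\<And>b. b \<in> B \<Longrightarrow> f \<bullet> b = 0" using w by auto
  have f_span: "f \<bullet> v = 0" if "v \<in> span B" for v
    using orthogonal_to_span[OF that, of f] fb by (simp add: orthogonal_def)
  have "span (insert w B) \<inter> {v. f \<bullet> v = 0} = span B"
  proof safe
    fix v assume "v \<in> span (insert w B)" "f \<bullet> v = 0"
    then obtain l where "v - l *\<^sub>R w \<in> span B" by (auto simp: span_breakdown_eq)
    then show "v \<in> span B" using f_span[of "v - l *\<^sub>R w"] \<open>f \<bullet> v = 0\<close> fw
      by (simp add: inner_diff_right)
  qed (use f_span span_mono[of B "insert w B"] in auto)
  then have hyperplane: "affine hull corner p B =
      affine hull corner p (insert w B) \<inter> {z. f \<bullet> z = f \<bullet> p}"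
    unfolding affine_hull_corner by (force simp: inner_add_right)
  have "w \<noteq> 0" using fw by auto
  then have "simplex_verts (corner p (insert w B)) - simplex_verts (corner p B) = {p + w}"
    using w by (auto simp: simplex_verts_corner[OF ind] simplex_verts_corner[OF B])
  moreover have "same_half_space (corner p B) (corner p (insert w B))
      (circumcenter (corner p (insert w B))) (p + w) \<longleftrightarrow> k > 0"
    using same_half_space_iff[OF hyperplane, of "circumcenter (corner p (insert w B))" "p + w"]
      corner_center(1)[OF ind, of p] f_span[OF k] fw
    by (simp add: affine_hull_corner circumcenter_corner inner_add_right inner_diff_right span_base)
  ultimately show ?thesis by (simp add: facet_sign_def)
qed

text \<open>The tetrahedron is a translate of the image of the standard simplex, of volume
  \<open>1/6\<close>, under the linear map with columns \<open>x\<close>, \<open>y\<close>,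
  \<open>z\<close>.\<close>

lemma measure_tetrahedron:
  fixes p x y z :: "real^3"
  shows "measure lebesgue (convex hull {p, p + x, p + y, p + z}) = \<bar>(x \<times> y) \<bullet> z\<bar> / 6"
proof -
  define f where "f v = v $ 1 *\<^sub>R x + v $ 2 *\<^sub>R y + v $ 3 *\<^sub>R z" for v :: "real^3"
  have lin: "linear f"
    by (rule linearI) (auto simp: f_def algebra_simps)
  have Basis: "(Basis :: (real^3) set) = {axis 1 1, axis 2 1, axis 3 1}"
    by (auto simp: Basis_vec_def UNIV_3)
  define T where "T = convex hull (insert 0 Basis :: (real^3) set)"
  have "f ` insert 0 Basis = {0, x, y, z}"
    by (simp add: Basis f_def axis_def)
  then have fT: "f ` T = convex hull {0, x, y, z}"
    by (simp add: T_def convex_hull_linear_image[OF lin])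
  have "compact T" unfolding T_def by (intro finite_imp_compact_convex_hull) auto
  then have T: "bounded T" "T \<in> sets lebesgue"
    by (auto intro: compact_imp_bounded lmeasurable_compact fmeasurableD)
  have "measure lebesgue T = 1 / 6"
    using content_std_simplex[where 'a = "real^3"] borel_compact[OF \<open>compact T\<close>]
    by (simp add: T_def[symmetric] fact_numeral)
  moreover have "\<bar>det (matrix f)\<bar> = \<bar>(x \<times> y) \<bullet> z\<bar>"
    by (simp add: matrix_def f_def axis_def det_3 cross3_simps)
  ultimately have "measure lebesgue (convex hull {0, x, y, z}) = \<bar>(x \<times> y) \<bullet> z\<bar> / 6"
    using measure_lebesgue_linear_transformation[OF T lin] by (simp add: fT)
  moreover have "convex hull {p, p + x, p + y, p + z} = (+) p ` (convex hull {0, x, y, z})"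
    using convex_hull_translation[of p "{0, x, y, z}"] by simp
  ultimately show ?thesis by (simp add: measure_translation)
qed

text \<open>
  The circumcenters of a chain are triangular in the frame \<open>a, b, c\<close>, and the facet signs are the
  signs of the diagonal entries. So the signed volume is a determinant, up to the orientation of
  the frame; on a vanishing diagonal entry both sides are zero.
\<close>

lemma elementary_dual_volume:
  fixes p a b c :: "real^3"
  assumes nz: "(a \<times> b) \<bullet> c \<noteq> 0"
  shows "facet_sign {p} (corner p {a}) * facet_sign (corner p {a}) (corner p {a, b}) *
      facet_sign (corner p {a, b}) (corner p {a, b, c}) *
      measure lebesgue (convex hull {circumcenter {p}, circumcenter (corner p {a}),
        circumcenter (corner p {a, b}), circumcenter (corner p {a, b, c})}) =
    sgn ((a \<times> b) \<bullet> c) * ((a \<times> corner_center p {a, b}) \<bullet> corner_center p {a, b, c}) / 12"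
proof -
  have i3: "independent {a, b, c}" by (rule det_nonzero_independent[OF nz])
  then have i2: "independent {a, b}" and i1: "independent {a}"
    by (rule independent_mono; blast)+
  have i0: "independent ({} :: (real^3) set)" by (rule independent_empty)
  note ne = det_nonzero_nonzero[OF nz]
  have "corner_center p {} = 0" using corner_center(1)[OF i0, of p] by simp
  then have c0: "circumcenter {p} = p"
    using circumcenter_corner[of p "{}"] by (simp add: corner_singleton)
  have s1: "corner_center p {a} = (1/2) *\<^sub>R a"
    by (rule dual_vector_span_unique[of _ "{a}"])
      (auto simp: span_base span_scale corner_center(1,2)[OF i1])
  have "corner_center p {a, b} \<in> span (insert b {a})"
    using corner_center(1)[OF i2, of p] by (simp add: insert_commute)
  then obtain k where k: "corner_center p {a, b} - k *\<^sub>R b \<in> span {a}"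
    by (auto simp: span_breakdown_eq)
  then obtain k' where k': "corner_center p {a, b} - k *\<^sub>R b = k' *\<^sub>R a"
    by (auto simp: span_singleton)
  have "corner_center p {a, b, c} \<in> span (insert c {a, b})"
    using corner_center(1)[OF i3, of p] by (simp add: insert_commute)
  then obtain l where l: "corner_center p {a, b, c} - l *\<^sub>R c \<in> span {a, b}"
    unfolding span_breakdown_eq[of _ c] by blast
  then obtain l1 l2 where "corner_center p {a, b, c} - l *\<^sub>R c - l1 *\<^sub>R a = l2 *\<^sub>R b"
    by (auto simp: span_breakdown_eq)
  then have c3: "corner_center p {a, b, c} = l *\<^sub>R c + l1 *\<^sub>R a + l2 *\<^sub>R b"
    by (simp add: algebra_simps)
  have c2: "corner_center p {a, b} = k *\<^sub>R b + k' *\<^sub>R a"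
    using k' by (simp add: algebra_simps)
  have vol: "(a \<times> corner_center p {a, b}) \<bullet> corner_center p {a, b, c} = k * l * ((a \<times> b) \<bullet> c)"
    by (simp add: c2 c3 cross_add_right cross_mult_right inner_add_right dot_cross_self)
  have "facet_sign {p} (corner p {a}) = 1"
    using facet_sign_corner[of a "{}" p "1/2"] i1 s1 by (simp add: corner_singleton)
  moreover have "facet_sign (corner p {a}) (corner p {a, b}) = (if k > 0 then 1 else -1)"
    using facet_sign_corner[of b "{a}" p k] i2 ne k by (simp add: insert_commute)
  moreover have "facet_sign (corner p {a, b}) (corner p {a, b, c}) = (if l > 0 then 1 else -1)"
    using facet_sign_corner[of c "{a, b}" p l] i3 ne l by (simp add: insert_commute)
  \<comment> \<open>The denominator \<open>12\<close> is the \<open>6\<close> of a tetrahedron times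
    the \<open>2\<close> from the midpoint of the edge \<open>a\<close>.\<close>
  moreover have "measure lebesgue (convex hull {circumcenter {p}, circumcenter (corner p {a}),
        circumcenter (corner p {a, b}), circumcenter (corner p {a, b, c})}) =
      \<bar>k * l * ((a \<times> b) \<bullet> c)\<bar> / 12"
    using measure_tetrahedron[of p "corner_center p {a}" "corner_center p {a, b}"
        "corner_center p {a, b, c}"] vol
    by (simp add: circumcenter_corner c0 s1 cross_mult_left)
  moreover have "(if k > 0 then 1 else -1) * (if l > 0 then 1 else -1) *
      \<bar>k * l * ((a \<times> b) \<bullet> c)\<bar> = sgn ((a \<times> b) \<bullet> c) * (k * l * ((a \<times> b) \<bullet> c))"
    unfolding abs_mult abs_sgn[of "(a \<times> b) \<bullet> c"] by (auto simp: abs_if)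
  ultimately show ?thesis
    by (simp only: vol mult_1_left times_divide_eq_right)
qed

section \<open>The star of an interior vertex\<close>

text \<open>The inverse of a chart at \<open>p\<close> is continuous and injective on an open set of
  the same dimension, so invariance of domain makes its image open in space.\<close>

lemma internal_vertex_interior:
  assumes "internal_vertex K p"
  shows "p \<in> interior (\<Union>K)"
proof -
  have "p \<in> \<Union>K" using assms by (auto simp: internal_vertex_def mesh_verts_def)
  then have "p \<in> manifold3_interior (\<Union>K)"
    using assms by (auto simp: internal_vertex_def manifold3_boundary_def)
  then obtain U and V :: "(real^3) set"
    where U: "openin (top_of_set (\<Union>K)) U" "p \<in> U" and "open V" "U homeomorphic V"
    by (auto simp: manifold3_interior_def)
  then obtain f g where "homeomorphism U V f g" by (auto simp: homeomorphic_def)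
  then have "continuous_on V g" "g ` V = U" "inj_on g V"
    by (auto simp: homeomorphism_def intro: inj_on_inverseI)
  then have "open U" using invariance_of_domain \<open>open V\<close> by metis
  moreover have "U \<subseteq> \<Union>K" using U(1) openin_imp_subset by blast
  ultimately show ?thesis using U(2) interior_maximal by blast
qed

lemma corner_rel_interior:
  fixes p :: "'a::euclidean_space"
  assumes B: "independent B" and k: "\<And>b. b \<in> B \<Longrightarrow> 0 < k b" "sum k B < 1"
  shows "p + (\<Sum>b\<in>B. k b *\<^sub>R b) \<in> rel_interior (corner p B)"
proof -
  have "0 \<notin> B" using B dependent_zero by blast
  then have p: "p \<notin> (+) p ` B" by auto
  have fin: "finite B" using B independent_imp_finite by blast
  \<comment> \<open>The barycentric coordinates; \<open>p\<close> takes the remaining weight,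
    positive since \<open>sum k B < 1\<close>.\<close>
  define u where "u x = (if x = p then 1 - sum k B else k (x - p))" for x
  have u: "u (p + b) = k b" if "b \<in> B" for b
    using that \<open>0 \<notin> B\<close> by (auto simp: u_def)
  have "sum u (insert p ((+) p ` B)) = 1"
    using p fin by (simp add: sum.reindex u) (simp add: u_def)
  moreover have "(\<Sum>x\<in>insert p ((+) p ` B). u x *\<^sub>R x) = p + (\<Sum>b\<in>B. k b *\<^sub>R b)"
    using p fin
    by (simp add: sum.reindex u) (simp add: u_def algebra_simps sum.distrib flip: scaleR_sum_left)
  moreover have "\<forall>x\<in>insert p ((+) p ` B). 0 < u x" using k u by (auto simp: u_def)
  ultimately show ?thesis
    unfolding corner_def rel_interior_convex_hull_explicit[OF corner_affine_independent[OF B]]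
    by blast
qed

lemma simplicial_complex_face:
  "\<lbrakk>simplicial_complex K; S \<in> K; F face_of S\<rbrakk> \<Longrightarrow> F \<in> K"
  by (simp add: simplicial_complex_def) blast

lemma simplicial_complex_Int:
  "\<lbrakk>simplicial_complex K; S \<in> K; T \<in> K\<rbrakk> \<Longrightarrow> S \<inter> T face_of S"
  by (simp add: simplicial_complex_def)

text \<open>\<open>S \<inter> T\<close> is a face of \<open>S\<close> that meets the relative
  interior of \<open>S\<close>, hence is all of \<open>S\<close>.\<close>

lemma simplicial_complex_subset_if_rel_interior:
  assumes K: "simplicial_complex K" "S \<in> K" "T \<in> K" and q: "q \<in> rel_interior S" "q \<in> T"
  shows "S \<subseteq> T"
proof -
  have "q \<in> S \<inter> T" using q rel_interior_subset by blast
  then show ?thesis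
    using subset_of_face_of[OF simplicial_complex_Int[OF K], of S] q by blast
qed

text \<open>
  Near \<open>p\<close> the face \<open>F\<close> has a relative interior point \<open>q\<close>, and the simplices not containing \<open>q\<close>
  stay away from it, so any short step from \<open>q\<close> ends in a simplex having \<open>F\<close> as a face.
\<close>

lemma exists_simplex_in_direction:
  fixes p v :: "'a::euclidean_space"
  assumes K: "simplicial_complex K" and p: "p \<in> interior (\<Union>K)"
    and F: "F \<in> K" "p \<in> F"
  obtains S q d where "S \<in> K" "F face_of S" "q \<in> F" "0 < d" "q + d *\<^sub>R v \<in> S"
proof -
  have simp: "\<exists>n. n simplex S" if "S \<in> K" for S using K that by (simp add: simplicial_complex_def)
  have conv: "convex F" using simp[OF F(1)] convex_simplex by blast
  obtain e where e: "e > 0" "ball p e \<subseteq> \<Union>K" using p mem_interior by blast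
  obtain c where c: "c \<in> rel_interior F" using conv F(2) rel_interior_eq_empty by blast
  \<comment> \<open>Small enough that moving from \<open>p\<close> towards \<open>c\<close> stays in
    the ball; the summand \<open>1\<close> covers the case \<open>c = p\<close>.\<close>
  define t where "t = min 1 (e / 2 / (1 + norm (p - c)))"
  have t: "0 < t" "t \<le> 1" using e(1) by (auto simp: t_def add_pos_nonneg)
  define q where "q = p - t *\<^sub>R (p - c)"
  have q: "q \<in> rel_interior F"
    unfolding q_def by (rule rel_interior_convex_shrink[OF conv c F(2) t])
  have "t * norm (p - c) \<le> e / 2 / (1 + norm (p - c)) * norm (p - c)"
    by (intro mult_right_mono) (auto simp: t_def)
  also have "\<dots> \<le> e / 2" using e(1) by (simp add: field_simps add_pos_nonneg)
  also have "\<dots> < e" using e(1) by simp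
  finally have "q \<in> ball p e" using t by (simp add: q_def dist_norm)
  \<comment> \<open>An open neighbourhood of \<open>q\<close> in which every point lies in a simplex
    that also contains \<open>q\<close>.\<close>
  define W where "W = ball p e - \<Union>{S \<in> K. q \<notin> S}"
  have "finite K" using K by (simp add: simplicial_complex_def)
  then have "closed (\<Union>{S \<in> K. q \<notin> S})"
    using simp closed_simplex by (intro closed_Union) auto
  then have "open W" by (auto simp: W_def)
  moreover have "q \<in> W" using \<open>q \<in> ball p e\<close> by (auto simp: W_def)
  ultimately obtain r where r: "r > 0" "ball q r \<subseteq> W" using open_contains_ball by blast
  define d where "d = r / 2 / (1 + norm v)"
  have d: "0 < d" using r(1) by (auto simp: d_def add_pos_nonneg)
  have "d * norm v \<le> r / 2" using r(1) by (simp add: d_def field_simps add_pos_nonneg)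
  then have "q + d *\<^sub>R v \<in> ball q r" using r(1) d by (simp add: dist_norm)
  then have W: "q + d *\<^sub>R v \<in> W" using r by blast
  then have "q + d *\<^sub>R v \<in> \<Union>K" using e by (auto simp: W_def)
  then obtain S where S: "S \<in> K" "q + d *\<^sub>R v \<in> S" "q \<in> S" using W by (auto simp: W_def)
  have "F \<subseteq> S" by (rule simplicial_complex_subset_if_rel_interior[OF K F(1) S(1) q S(3)])
  then have "F face_of S" using simplicial_complex_Int[OF K S(1) F(1)] by (simp add: Int_absorb1)
  then show ?thesis using that S d q rel_interior_subset by blast
qed

text \<open>The simplex found in the direction \<open>v\<close> has \<open>{p}\<close> as a face, so
  it too is a corner at \<open>p\<close>, and its face gives a subset of its edge vectors.\<close>

lemma exists_corner_in_direction:
  fixes p v :: "real^3"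
  assumes K: "simplicial_complex K" and p: "p \<in> interior (\<Union>K)"
    and B: "independent B" "corner p B \<in> K"
  obtains B' q d where "independent B'" "B \<subseteq> B'" "corner p B' \<in> K" "q \<in> corner p B" "0 < d"
    "q + d *\<^sub>R v \<in> corner p B'"
proof -
  have pB: "p \<in> corner p B" by (simp add: corner_def hull_inc)
  obtain S q d where S: "S \<in> K" "corner p B face_of S" "q \<in> corner p B" "0 < d"
      "q + d *\<^sub>R v \<in> S"
    using exists_simplex_in_direction[OF K p B(2) pB] by metis
  obtain n where n: "n simplex S" using K S(1) by (auto simp: simplicial_complex_def)
  have "{p} face_of corner p B" using corner_face[OF B(1), of "{}" p] by (simp add: corner_singleton)
  then have "{p} face_of S" using S(2) face_of_trans by blast
  then obtain B' where B': "independent B'" "S = corner p B'" using simplex_corner[OF n] by metis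
  obtain A where A: "A \<subseteq> B'" "corner p B = corner p A"
    using face_corner[OF B'(1)] S(2) pB B'(2) by metis
  have "B = A" using corner_inject[OF B(1) _ A(2)] independent_mono[OF B'(1) A(1)] by simp
  then show ?thesis using that B' A(1) S by blast
qed

text \<open>A step in a direction outside the span leaves the affine hull, so the simplex reached
  has a further edge vector; the face with just this one added is again in \<open>K\<close>.\<close>

lemma exists_corner_insert:
  fixes p :: "real^3"
  assumes K: "simplicial_complex K" and p: "p \<in> interior (\<Union>K)"
    and B: "independent B" "corner p B \<in> K" and v: "v \<notin> span B"
  obtains w where "w \<notin> B" "independent (insert w B)" "corner p (insert w B) \<in> K"
proof -
  obtain B' q d where B': "independent B'" "B \<subseteq> B'" "corner p B' \<in> K"
      and q: "q \<in> corner p B" "0 < d" "q + d *\<^sub>R v \<in> corner p B'"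
    using exists_corner_in_direction[OF K p B, of v] by metis
  have "B' \<noteq> B"
  proof
    assume [simp]: "B' = B"
    have "q \<in> affine hull corner p B" "q + d *\<^sub>R v \<in> affine hull corner p B"
      using q by (auto simp: hull_inc)
    then have "q - p \<in> span B" "q + d *\<^sub>R v - p \<in> span B"
      unfolding affine_hull_corner by auto
    from span_diff[OF this(2,1)] have "d *\<^sub>R v \<in> span B" by simp
    then show False using v q(2) span_scale[of "d *\<^sub>R v" B "1 / d"] by simp
  qed
  then obtain w where w: "w \<in> B'" "w \<notin> B" using B'(2) by blast
  have sub: "insert w B \<subseteq> B'" using w B'(2) by blast
  show ?thesis
    using that w(2) independent_mono[OF B'(1) sub]
      simplicial_complex_face[OF K B'(3) corner_face[OF B'(1) sub]] by blast
qed

text \<open>The simplex \<open>{p}\<close> is enlarged three times by one edge vector, which is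
  possible because fewer than three vectors do not span space.\<close>

lemma exists_tetrahedron:
  fixes p :: "real^3"
  assumes K: "simplicial_complex K" and p: "p \<in> interior (\<Union>K)" "{p} \<in> K"
  shows "\<exists>a b c. (a \<times> b) \<bullet> c \<noteq> 0 \<and> corner p {a, b, c} \<in> K"
proof -
  have small: "\<exists>v. v \<notin> span B" if "finite B" "card B < 3" for B :: "(real^3) set"
  proof (rule ccontr)
    assume "\<not> ?thesis"
    then have "span B = UNIV" by auto
    then have "dim (UNIV :: (real^3) set) = dim B" by (metis dim_span)
    then show False using dim_le_card'[OF that(1)] that(2) by simp
  qed
  have "independent ({} :: (real^3) set)" "corner p {} \<in> K"
    using p(2) by (auto simp: corner_singleton independent_empty)
  then obtain c where c: "independent {c}" "corner p {c} \<in> K"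
    using exists_corner_insert[OF K p(1)] small[of "{}"] by (metis card.empty finite.emptyI zero_less_numeral)
  obtain b where b: "b \<notin> {c}" "independent {b, c}" "corner p {b, c} \<in> K"
    using exists_corner_insert[OF K p(1) c] small[of "{c}"] by auto
  obtain v where "v \<notin> span {b, c}" using small[of "{b, c}"] b(1) by auto
  then obtain a where a: "a \<notin> {b, c}" "independent {a, b, c}" "corner p {a, b, c} \<in> K"
    using exists_corner_insert[OF K p(1) b(2,3)] by metis
  then show ?thesis using b(1) independent_det_nonzero[of a b c] by auto
qed

text \<open>A short step from the triangle in the direction \<open>v\<close> ends strictly on the
  positive side of its plane, so the simplex reached has an edge vector \<open>c\<close> pointing to
  that side.\<close>

lemma exists_tetrahedron_on_side:
  fixes p a b v :: "real^3"
  assumes K: "simplicial_complex K" and p: "p \<in> interior (\<Union>K)"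
    and ab: "independent {a, b}" "corner p {a, b} \<in> K" and v: "0 < (a \<times> b) \<bullet> v"
  shows "\<exists>c. corner p {a, b, c} \<in> K \<and> 0 < (a \<times> b) \<bullet> c"
proof -
  obtain B q d where B: "independent B" "{a, b} \<subseteq> B" "corner p B \<in> K"
      and q: "q \<in> corner p {a, b}" "0 < d" "q + d *\<^sub>R v \<in> corner p B"
    using exists_corner_in_direction[OF K p ab, of v] by metis
  define n where "n = a \<times> b"
  have half: "corner p A \<subseteq> {x. n \<bullet> x \<le> n \<bullet> p}" if "\<And>x. x \<in> A \<Longrightarrow> n \<bullet> x \<le> 0" for A
    unfolding corner_def
    by (intro hull_minimal convex_halfspace_le) (auto simp: inner_add_right that)
  have half': "corner p A \<subseteq> {x. n \<bullet> x \<ge> n \<bullet> p}" if "\<And>x. x \<in> A \<Longrightarrow> n \<bullet> x \<ge> 0" for A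
    unfolding corner_def
    by (intro hull_minimal convex_halfspace_ge) (auto simp: inner_add_right that)
  have "corner p {a, b} \<subseteq> {x. n \<bullet> x \<ge> n \<bullet> p}" by (rule half') (auto simp: n_def dot_cross_self)
  then have "n \<bullet> q \<ge> n \<bullet> p" using q(1) by blast
  moreover have "0 < d * (n \<bullet> v)" using v q(2) by (simp add: n_def)
  ultimately have "\<not> n \<bullet> (q + d *\<^sub>R v) \<le> n \<bullet> p" by (simp add: inner_add_right)
  \<comment> \<open>Otherwise \<open>half\<close> would confine the whole simplex to the other
    closed half space.\<close>
  then obtain c where c: "c \<in> B" "n \<bullet> c > 0" using half[of B] q(3) by (metis mem_Collect_eq not_le subsetD)
  have "{a, b, c} \<subseteq> B" using B(2) c by auto
  then have "corner p {a, b, c} \<in> K"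
    using simplicial_complex_face[OF K B(3)] corner_face[OF B(1)] by blast
  then show ?thesis using c(2) by (auto simp: n_def)
qed

text \<open>Two tetrahedra on the same side of a common triangle share an interior point just above
  the triangle: since \<open>c'\<close> has a positive \<open>c\<close>-coordinate \<open>z\<close>,
  a small step along \<open>c'\<close> enters both.\<close>

lemma corner_tetrahedron_subset:
  fixes p a b c c' :: "real^3"
  assumes K: "simplicial_complex K" "corner p {a, b, c} \<in> K" "corner p {a, b, c'} \<in> K"
    and nz: "(a \<times> b) \<bullet> c \<noteq> 0" and same: "sgn ((a \<times> b) \<bullet> c') = sgn ((a \<times> b) \<bullet> c)"
  shows "corner p {a, b, c} \<subseteq> corner p {a, b, c'}"
proof -
  have nz': "(a \<times> b) \<bullet> c' \<noteq> 0" using nz same by (metis sgn_zero_iff)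
  note ind = det_nonzero_independent[OF nz] and ind' = det_nonzero_independent[OF nz']
  note ne = det_nonzero_nonzero[OF nz] and ne' = det_nonzero_nonzero[OF nz']
  have "card {a, b, c} = 3" using ne by simp
  then have "UNIV \<subseteq> span {a, b, c}" using ind by (intro card_ge_dim_independent) auto
  then have "c' \<in> span {a, b, c}" by blast
  then obtain x y z where "c' - x *\<^sub>R a - y *\<^sub>R b = z *\<^sub>R c" by (auto simp: span_breakdown_eq)
  then have c': "c' = x *\<^sub>R a + y *\<^sub>R b + z *\<^sub>R c" by (simp add: algebra_simps)
  have "(a \<times> b) \<bullet> c' = z * ((a \<times> b) \<bullet> c)"
    by (simp add: c' inner_add_right dot_cross_self)
  then have "sgn z * sgn ((a \<times> b) \<bullet> c) = sgn ((a \<times> b) \<bullet> c)" using same by (simp add: sgn_mult)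
  then have z: "0 < z" using nz by (simp add: sgn_zero_iff sgn_1_pos)
  \<comment> \<open>Each coordinate then changes by at most \<open>1/8\<close>: the weights
    \<open>1/4\<close> stay positive and the total is at most \<open>7/8\<close>.\<close>
  define d where "d = 1 / (8 * (1 + \<bar>x\<bar> + \<bar>y\<bar> + \<bar>z\<bar>))"
  have d: "0 < d" by (simp add: d_def add_pos_nonneg)
  have eq: "d * (1 + \<bar>x\<bar> + \<bar>y\<bar> + \<bar>z\<bar>) = 1 / 8" by (simp add: d_def)
  have "0 \<le> d * \<bar>x\<bar>" "0 \<le> d * \<bar>y\<bar>" "0 \<le> d * \<bar>z\<bar>" using d by auto
  moreover have "d + d * \<bar>x\<bar> + d * \<bar>y\<bar> + d * \<bar>z\<bar> = 1 / 8" using eq by (simp add: algebra_simps)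
  ultimately have bounds: "d \<le> 1 / 8" "\<bar>d * x\<bar> \<le> 1 / 8" "\<bar>d * y\<bar> \<le> 1 / 8" "\<bar>d * z\<bar> \<le> 1 / 8"
    using d by (simp_all only: abs_mult abs_of_pos)
  have tri: "p + (r *\<^sub>R a + s *\<^sub>R b + t *\<^sub>R e) \<in> rel_interior (corner p {a, b, e})"
    if "independent {a, b, e}" "a \<noteq> b" "a \<noteq> e" "b \<noteq> e" "0 < r" "0 < s" "0 < t" "r + s + t < 1"
    for r s t :: real and e
    using corner_rel_interior[OF that(1), of "\<lambda>v. if v = a then r else if v = b then s else t" p]
      that by (auto simp: add.assoc)
  define q where "q = p + ((1/4) *\<^sub>R a + (1/4) *\<^sub>R b + d *\<^sub>R c')"
  have "q \<in> rel_interior (corner p {a, b, c'})"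
    unfolding q_def by (rule tri) (use ind' ne' d bounds in auto)
  moreover have "q = p + ((1/4 + d * x) *\<^sub>R a + (1/4 + d * y) *\<^sub>R b + (d * z) *\<^sub>R c)"
    by (simp add: q_def c' algebra_simps)
  moreover have "p + ((1/4 + d * x) *\<^sub>R a + (1/4 + d * y) *\<^sub>R b + (d * z) *\<^sub>R c)
      \<in> rel_interior (corner p {a, b, c})"
    by (rule tri) (use ind ne d z bounds in auto)
  ultimately show ?thesis
    using simplicial_complex_subset_if_rel_interior[OF K(1) K(2,3)] rel_interior_subset by auto
qed

lemma tetrahedron_on_side_unique:
  fixes p a b c c' :: "real^3"
  assumes K: "simplicial_complex K" "corner p {a, b, c} \<in> K" "corner p {a, b, c'} \<in> K"
    and nz: "(a \<times> b) \<bullet> c \<noteq> 0" and same: "sgn ((a \<times> b) \<bullet> c') = sgn ((a \<times> b) \<bullet> c)"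
  shows "c = c'"
proof -
  have nz': "(a \<times> b) \<bullet> c' \<noteq> 0" using nz same by (metis sgn_zero_iff)
  have "corner p {a, b, c} = corner p {a, b, c'}"
    using corner_tetrahedron_subset[OF K nz same]
      corner_tetrahedron_subset[OF K(1,3,2) nz' same[symmetric]] by blast
  then have "{a, b, c} = {a, b, c'}"
    using corner_inject det_nonzero_independent nz nz' by blast
  then have "c' \<in> {a, b, c}" by auto
  then show ?thesis using det_nonzero_nonzero[OF nz'] by auto
qed

section \<open>The dual of an interior vertex\<close>

text \<open>The circumscribed sphere passes through \<open>p\<close>, so being outside its open ball
  means being at least as far from the center as \<open>p\<close> is.\<close>

lemma delaunay_corner:
  assumes K: "delaunay K" and S: "corner p {a, b, c} \<in> K" "(a \<times> b) \<bullet> c \<noteq> 0"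
    and v: "p + v \<in> mesh_verts K"
  shows "corner_center p {a, b, c} \<bullet> v \<le> (v \<bullet> v) / 2"
proof -
  note ind = det_nonzero_independent[OF S(2)]
  have "3 simplex corner p {a, b, c}"
    using corner_simplex[OF ind, of p] det_nonzero_nonzero[OF S(2)] by simp
  then have "p + v \<notin> ball (circumcenter (corner p {a, b, c})) (circumradius (corner p {a, b, c}))"
    using K S(1) v unfolding delaunay_def by blast
  then show ?thesis
    using dist_corner_eq_iff(2)[of p "corner_center p {a, b, c}" v]
    by (simp add: circumcenter_corner corner_center(3)[OF ind])
qed

text \<open>The strict condition is applied across the common triangle
  \<open>corner p {a, b}\<close>, with \<open>p + c'\<close> as the vertex off that
  triangle.\<close>

lemma nondegenerate_delaunay_corner:
  assumes K: "nondegenerate_delaunay K"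
    and S: "corner p {a, b, c} \<in> K" "(a \<times> b) \<bullet> c \<noteq> 0"
    and T: "corner p {a, b, c'} \<in> K" "(a \<times> b) \<bullet> c' \<noteq> 0" and ne: "c \<noteq> c'"
  shows "corner_center p {a, b, c} \<bullet> c' < (c' \<bullet> c') / 2"
proof -
  note ind = det_nonzero_independent[OF S(2)] and ind' = det_nonzero_independent[OF T(2)]
  note nz = det_nonzero_nonzero[OF S(2)] and nz' = det_nonzero_nonzero[OF T(2)]
  have ind2: "independent {a, b}" using ind by (rule independent_mono) auto
  have simplices: "3 simplex corner p {a, b, c}" "3 simplex corner p {a, b, c'}"
      "2 simplex corner p {a, b}"
    using corner_simplex[OF ind, of p] corner_simplex[OF ind', of p] corner_simplex[OF ind2, of p]
      nz nz' by simp_all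
  have "{a, b, c} \<noteq> {a, b, c'}" using ne nz nz' by auto
  then have "corner p {a, b, c} \<noteq> corner p {a, b, c'}" using corner_inject[OF ind ind'] by blast
  moreover have "corner p {a, b} face_of corner p {a, b, c}"
      "corner p {a, b} face_of corner p {a, b, c'}"
    by (rule corner_face[OF ind] corner_face[OF ind'], blast)+
  moreover have "p + c' \<in> simplex_verts (corner p {a, b, c'}) - simplex_verts (corner p {a, b})"
    using nz' by (simp add: simplex_verts_corner[OF ind'] simplex_verts_corner[OF ind2])
  ultimately have "circumradius (corner p {a, b, c}) < dist (circumcenter (corner p {a, b, c})) (p + c')"
    using K S(1) T(1) simplices unfolding nondegenerate_delaunay_def by blast
  then show ?thesis
    using dist_corner_eq_iff(3)[of "corner_center p {a, b, c}" p c']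
    by (simp add: circumcenter_corner corner_center(3)[OF ind])
qed

lemma corner_mesh_verts:
  assumes "simplicial_complex K" "corner p B \<in> K" "independent B" "b \<in> B"
  shows "p + b \<in> mesh_verts K"
proof -
  have "(p + b) extreme_point_of corner p B"
    using simplex_verts_corner[OF assms(3), of p] assms(4) by (auto simp: simplex_verts_def)
  then show ?thesis
    using simplicial_complex_face[OF assms(1,2)] by (simp add: mesh_verts_def face_of_singleton)
qed

text \<open>Ordered triples of edge vectors, so each tetrahedron at \<open>p\<close> occurs six
  times, once for each flag starting at \<open>p\<close>.\<close>

definition star_frames :: "(real^3) set set \<Rightarrow> real^3 \<Rightarrow> ((real^3) \<times> (real^3) \<times> (real^3)) set" where
  "star_frames K p = {(a, b, c). (a \<times> b) \<bullet> c \<noteq> 0 \<and> corner p {a, b, c} \<in> K}"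

lemma star_frames_dual_chains:
  assumes K: "simplicial_complex K"
  shows "bij_betw (\<lambda>(a, b, c). (corner p {a}, corner p {a, b}, corner p {a, b, c}))
    (star_frames K p) (dual_chains K p)"
  unfolding bij_betw_def
proof (intro conjI subset_antisym)
  have ind: "independent {a}" "independent {a, b}" "independent {a, b, c}"
    if "(a \<times> b) \<bullet> c \<noteq> 0" for a b c :: "real^3"
    by (rule independent_mono[OF det_nonzero_independent[OF that]]; blast)+
  show "inj_on (\<lambda>(a, b, c). (corner p {a}, corner p {a, b}, corner p {a, b, c})) (star_frames K p)"
  proof (rule inj_onI)
    fix t t' assume t: "t \<in> star_frames K p" "t' \<in> star_frames K p"
      and eq_t: "(\<lambda>(a, b, c). (corner p {a}, corner p {a, b}, corner p {a, b, c})) t =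
        (\<lambda>(a, b, c). (corner p {a}, corner p {a, b}, corner p {a, b, c})) t'"
    obtain a b c a' b' c' where tt: "t = (a, b, c)" "t' = (a', b', c')" using prod_cases3 by metis
    then have nz: "(a \<times> b) \<bullet> c \<noteq> 0" "(a' \<times> b') \<bullet> c' \<noteq> 0" using t by (auto simp: star_frames_def)
    have eq: "corner p {a} = corner p {a'}" "corner p {a, b} = corner p {a', b'}"
      "corner p {a, b, c} = corner p {a', b', c'}" using eq_t tt by auto
    have "{a} = {a'}" "{a, b} = {a', b'}" "{a, b, c} = {a', b', c'}"
      using eq ind[OF nz(1)] ind[OF nz(2)] corner_inject by blast+
    then have "a = a' \<and> b = b' \<and> c = c'"
      using det_nonzero_nonzero[OF nz(1)] det_nonzero_nonzero[OF nz(2)] by fast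
    then show "t = t'" using tt by simp
  qed
  show "(\<lambda>(a, b, c). (corner p {a}, corner p {a, b}, corner p {a, b, c})) ` star_frames K p
      \<subseteq> dual_chains K p"
  proof clarify
    fix a b c assume "(a, b, c) \<in> star_frames K p"
    then have nz: "(a \<times> b) \<bullet> c \<noteq> 0" and S: "corner p {a, b, c} \<in> K" by (auto simp: star_frames_def)
    note i = ind[OF nz] and ne = det_nonzero_nonzero[OF nz]
    have "1 simplex corner p {a}" "2 simplex corner p {a, b}" "3 simplex corner p {a, b, c}"
      using corner_simplex[OF i(1), of p] corner_simplex[OF i(2), of p] corner_simplex[OF i(3), of p]
        ne by simp_all
    moreover have "{p} face_of corner p {a}"
      using corner_face[OF i(1), of "{}" p] by (simp add: corner_singleton)
    moreover have "corner p {a} face_of corner p {a, b}" by (rule corner_face[OF i(2)]) auto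
    moreover have "corner p {a, b} face_of corner p {a, b, c}" by (rule corner_face[OF i(3)]) auto
    ultimately show "(corner p {a}, corner p {a, b}, corner p {a, b, c}) \<in> dual_chains K p"
      using S simplicial_complex_face[OF K] by (auto simp: dual_chains_def)
  qed
  show "dual_chains K p \<subseteq>
      (\<lambda>(a, b, c). (corner p {a}, corner p {a, b}, corner p {a, b, c})) ` star_frames K p"
  proof clarify
    fix S1 S2 S3 assume "(S1, S2, S3) \<in> dual_chains K p"
    then have S: "S3 \<in> K" "1 simplex S1" "2 simplex S2" "3 simplex S3"
        and f: "{p} face_of S1" "S1 face_of S2" "S2 face_of S3"
      by (auto simp: dual_chains_def)
    have f2: "{p} face_of S2" using f face_of_trans by blast
    then have f3: "{p} face_of S3" using f face_of_trans by blast
    obtain C where C: "independent C" "int (card C) = 3" "S3 = corner p C"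
      using simplex_corner[OF S(4) f3] .
    obtain B where B: "independent B" "int (card B) = 2" "S2 = corner p B"
      using simplex_corner[OF S(3) f2] .
    obtain A where A: "independent A" "int (card A) = 1" "S1 = corner p A"
      using simplex_corner[OF S(2) f(1)] .
    \<comment> \<open>Nested faces through \<open>p\<close> have nested sets of edge vectors;
      cardinalities \<open>1\<close>, \<open>2\<close>, \<open>3\<close> then name one new vector at
      each stage.\<close>
    have sub: "A \<subseteq> B" if A: "independent A" and B: "independent B"
      and F: "corner p A face_of corner p B" for A B
    proof -
      have "p \<in> corner p A" by (simp add: corner_def hull_inc)
      then obtain A' where A': "A' \<subseteq> B" "corner p A = corner p A'"
        using face_corner[OF B F] by metis
      then have "A = A'" using corner_inject[OF A] independent_mono[OF B] by blast
      then show ?thesis using A' by simp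
    qed
    have AB: "A \<subseteq> B" "B \<subseteq> C" using sub A B C f by blast+
    obtain a where a: "A = {a}" using A(2) card_1_singletonE[of A] by auto
    have "card (B - A) = 1" using A B AB by (subst card_Diff_subset) (auto intro: independent_imp_finite)
    then obtain b where b: "B - A = {b}" using card_1_singletonE by metis
    have "card (C - B) = 1" using B C AB by (subst card_Diff_subset) (auto intro: independent_imp_finite)
    then obtain c where c: "C - B = {c}" using card_1_singletonE by metis
    have eqB: "B = {a, b}" and eqC: "C = {a, b, c}" and "a \<noteq> b" "a \<noteq> c" "b \<noteq> c"
      using a b c AB by blast+
    then have "(a \<times> b) \<bullet> c \<noteq> 0" using independent_det_nonzero C(1) by blast
    then have "(a, b, c) \<in> star_frames K p" using S(1) C(3) eqC by (simp add: star_frames_def)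
    then show "(S1, S2, S3) \<in>
        (\<lambda>(a, b, c). (corner p {a}, corner p {a, b}, corner p {a, b, c})) ` star_frames K p"
      using A(3) B(3) C(3) a eqB eqC by (intro image_eqI[of _ _ "(a, b, c)"]) auto
  qed
qed

lemma finite_star_frames:
  assumes K: "simplicial_complex K"
  shows "finite (star_frames K p)"
proof -
  have "dual_chains K p \<subseteq> Sigma K (\<lambda>_. Sigma K (\<lambda>_. K))" by (auto simp: dual_chains_def)
  moreover have "finite K" using K by (simp add: simplicial_complex_def)
  ultimately have "finite (dual_chains K p)" by (meson finite_SigmaI finite_subset)
  then show ?thesis using bij_betw_finite[OF star_frames_dual_chains[OF K]] by blast
qed

lemma signed_dual_volume_frames:
  assumes K: "simplicial_complex K"
  shows "signed_dual_volume K p = (\<Sum>(a, b, c)\<in>star_frames K p.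
    sgn ((a \<times> b) \<bullet> c) * ((a \<times> corner_center p {a, b}) \<bullet> corner_center p {a, b, c})) / 12"
  unfolding signed_dual_volume_def
  by (subst sum.reindex_bij_betw[OF star_frames_dual_chains[OF K], symmetric])
    (auto simp: sum_divide_distrib star_frames_def elementary_dual_volume intro!: sum.cong)

text \<open>The dual polygon of the edge \<open>a\<close>: \<open>M\<close> lists the tetrahedra
  around it, with \<open>P\<close> and \<open>Q\<close> the circumcenters of its triangles and
  tetrahedra.\<close>

lemma edge_contribution_pos:
  fixes p a :: "real^3"
  assumes K: "simplicial_complex K" and del: "nondegenerate_delaunay K"
    and p: "p \<in> interior (\<Union>K)" and a: "a \<in> fst ` star_frames K p"
  defines "M \<equiv> {(b, c). (a, b, c) \<in> star_frames K p}"
  shows "0 < (\<Sum>(b, c)\<in>M. sgn ((a \<times> b) \<bullet> c) *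
    ((a \<times> corner_center p {a, b}) \<bullet> corner_center p {a, b, c}))"
proof (rule dual_polygon_area_pos)
  have M: "(b, c) \<in> M \<longleftrightarrow> (a \<times> b) \<bullet> c \<noteq> 0 \<and> corner p {a, b, c} \<in> K" for b c
    by (simp add: M_def star_frames_def)
  have "M = Pair a -` star_frames K p" by (auto simp: M_def)
  then show "finite M"
    using finite_vimageI[OF finite_star_frames[OF K], of "Pair a"] by (simp add: inj_on_def)
  show "M \<noteq> {}" using a by (fastforce simp: M_def)
  have ind: "independent {a, b, c}" "independent {a, b}" if "(b, c) \<in> M" for b c
    using that by (rule_tac independent_mono[OF det_nonzero_independent[of a b c]]; auto simp: M)+
  show "(c, b) \<in> M" if "(b, c) \<in> M" for b c
    using that cross_triple_skew[of a b c] by (simp add: M insert_commute)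
  show "corner_center p {a, b, c} = corner_center p {a, c, b}" for b c
    by (simp add: insert_commute)
  fix b c assume bc: "(b, c) \<in> M"
  show "(a \<times> b) \<bullet> c \<noteq> 0" using bc by (simp add: M)
  show "corner_center p {a, b, c} \<bullet> a = (a \<bullet> a) / 2" "corner_center p {a, b, c} \<bullet> b = (b \<bullet> b) / 2"
    by (rule corner_center(2)[OF ind(1)[OF bc]], simp)+
  show "corner_center p {a, b} \<bullet> a = (a \<bullet> a) / 2" "corner_center p {a, b} \<bullet> b = (b \<bullet> b) / 2"
    by (rule corner_center(2)[OF ind(2)[OF bc]], simp)+
  have abK: "corner p {a, b} \<in> K"
    using bc simplicial_complex_face[OF K _ corner_face[OF ind(1)[OF bc], of "{a, b}" p]]
    by (auto simp: M)
  show "\<exists>c'. (b, c') \<in> M \<and> sgn ((a \<times> b) \<bullet> c') = - sgn ((a \<times> b) \<bullet> c)"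
  proof (cases "(a \<times> b) \<bullet> c > 0")
    case True
    \<comment> \<open>The existence lemma serves the positive side only; exchanging \<open>a\<close>
      and \<open>b\<close> reverses the orientation.\<close>
    have "0 < (b \<times> a) \<bullet> (- c)" using True cross_skew[of b a] by simp
    then obtain c' where c': "corner p {b, a, c'} \<in> K" "0 < (b \<times> a) \<bullet> c'"
      using exists_tetrahedron_on_side[OF K p, of b a "- c"] ind(2)[OF bc] abK
      by (auto simp: insert_commute)
    then have "(a \<times> b) \<bullet> c' < 0" using cross_skew[of b a] by simp
    then show ?thesis using c'(1) True by (intro exI[of _ c']) (simp add: M insert_commute)
  next
    case False
    then have "(a \<times> b) \<bullet> c < 0" using bc by (simp add: M)
    moreover from this obtain c' where "corner p {a, b, c'} \<in> K" "0 < (a \<times> b) \<bullet> c'"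
      using exists_tetrahedron_on_side[OF K p, of a b "- c"] ind(2)[OF bc] abK by auto
    ultimately show ?thesis by (intro exI[of _ c']) (simp add: M)
  qed
  show "c = c'" if "(b, c') \<in> M" "sgn ((a \<times> b) \<bullet> c') = sgn ((a \<times> b) \<bullet> c)" for c'
    using tetrahedron_on_side_unique[OF K] bc that unfolding M by blast
  show "corner_center p {a, b, c} \<bullet> b' \<le> (b' \<bullet> b') / 2" if "(b', c') \<in> M" for b' c'
  proof (rule delaunay_corner)
    show "p + b' \<in> mesh_verts K"
      using corner_mesh_verts[OF K _ ind(1)[OF that], of p b'] that by (simp add: M)
  qed (use bc del in \<open>auto simp: M nondegenerate_delaunay_def\<close>)
  show "corner_center p {a, b, c} \<bullet> c' < (c' \<bullet> c') / 2" if "(b, c') \<in> M" "c \<noteq> c'" for c'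
    using nondegenerate_delaunay_corner[OF del] bc that unfolding M by blast
qed

theorem theorem6:
  fixes K :: "(real^3) set set"
    and \<tau> :: "real^3"
  assumes "tetrahedral_mesh K"
    and "nondegenerate_delaunay K"
    and "internal_vertex K \<tau>"
  shows "signed_dual_volume K \<tau> > 0"
proof -
  have K: "simplicial_complex K" using assms(1) by (simp add: tetrahedral_mesh_def)
  note \<tau> = internal_vertex_interior[OF assms(3)]
  define N where "N = star_frames K \<tau>"
  define A where "A = fst ` N"
  define M where "M a = {(b, c). (a, b, c) \<in> N}" for a
  define g where "g a = (\<lambda>(b, c). sgn ((a \<times> b) \<bullet> c) *
    ((a \<times> corner_center \<tau> {a, b}) \<bullet> corner_center \<tau> {a, b, c}))" for a
  have fin: "finite N" unfolding N_def by (rule finite_star_frames[OF K])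
  \<comment> \<open>Grouping frames by their first vector splits the sum into the edges at
    \<open>\<tau>\<close>.\<close>
  have N: "N = Sigma A M" by (force simp: A_def M_def)
  have "\<exists>a b c. (a \<times> b) \<bullet> c \<noteq> 0 \<and> corner \<tau> {a, b, c} \<in> K"
    using exists_tetrahedron[OF K \<tau>] assms(3) by (simp add: internal_vertex_def mesh_verts_def)
  then have "A \<noteq> {}" by (auto simp: A_def N_def star_frames_def)
  moreover have "finite A" using fin by (simp add: A_def)
  moreover have "0 < sum (g a) (M a)" if "a \<in> A" for a
    using edge_contribution_pos[OF K assms(2) \<tau>, of a] that
    by (simp add: A_def N_def M_def g_def)
  ultimately have "0 < (\<Sum>a\<in>A. sum (g a) (M a))" by (intro sum_pos[where f = "\<lambda>a. sum (g a) (M a)"])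
  also have "\<dots> = (\<Sum>(a, bc)\<in>N. g a bc)"
  proof -
    have "finite (M a)" for a
      by (rule finite_subset[of _ "snd ` N"]) (use fin in \<open>force simp: M_def\<close>)+
    then show ?thesis unfolding N using \<open>finite A\<close> by (simp add: sum.Sigma)
  qed
  also have "\<dots> = 12 * signed_dual_volume K \<tau>"
    by (simp add: signed_dual_volume_frames[OF K] N_def g_def case_prod_unfold)
  finally show ?thesis by simp
qed

end
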